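(* For any $A,B,B',C,C'\in\widehat{\mathbb{F}_q}$, any $x\in\mathbb{F}_q^*$, any $y\in\mathbb{F}_q$ and any $t\in\mathbb{F}_q^*\setminus\{1\}$, $$\frac{1}{q-1}\sum_{\theta}\binom{A\theta}{\theta}F_{2}(A\theta;B,B';C,C';x,y)\,\theta(t)=\overline{A}(1-t)\,F_{2}\left(A;B,B';C,C';\frac{x}{1-t},\frac{y}{1-t}\right)$$ $$\qquad-\overline{A}(-t)\,\overline{C'}(y)\,\overline{B'}C'(1-y)\,{}_{2}F_1\left(\begin{matrix}A,B\\ C\end{matrix}\bigg|\,-\frac{x}{t}\right)$$ $$\qquad-\overline{A}(-t)\left(\binom{B}{C}\binom{B'}{C'}\varepsilon(y)-F_{2}(\varepsilon;B,B';C,C';x,y)\right)$$ $$\qquad+BC(-1)\,\overline{A}(-x)\,\overline{C'}(y)\,\overline{B'}C'(1-y)\,{}_{2}F_1\left(\begin{matrix}A,A\overline{C}\\ A\overline{B}\end{matrix}\bigg|\,-\frac{t}{x}\right),$$ where $\theta$ ranges over all multiplicative characters of $\mathbb{F}_q$.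
   Context: Let $q$ be a power of a prime, $\mathbb{F}_q$ the field with $q$ elements, and $\widehat{\mathbb{F}_q}$ the group of (complex-valued) multiplicative characters of $\mathbb{F}_q^*$. Every character $\chi$, including the trivial character $\varepsilon$, is extended to $\mathbb{F}_q$ by $\chi(0)=0$. $\overline{\chi}$ denotes the inverse of $\chi$. Products of characters are evaluated pointwise, e.g. $\overline{B'}C'(1-y)=\overline{B'}(1-y)C'(1-y)$ and $BC(-1)=B(-1)C(-1)$. Jacobi sum: $J(\chi,\lambda)=\sum_{u\in\mathbb{F}_q}\chi(u)\lambda(1-u)$. Binomial coefficient of characters: $\binom{A}{B}=B(-1)J(A,\overline{B})$. Finite field ${}_2F_1$: for $A,B,C\in\widehat{\mathbb{F}_q}$ and $x\in\mathbb{F}_q$, $${}_{2}F_1\left(\begin{matrix}A,B\\ C\end{matrix}\bigg|\,x\right)=\varepsilon(x)\,BC(-1)\sum_{u\in\mathbb{F}_q}B(u)\,\overline{B}C(1-u)\,\overline{A}(1-xu).$$ The finite field Appell series $F_2$ is defined, for $A,B,B',C,C'\in\widehat{\mathbb{F}_q}$ and $x,y\in\mathbb{F}_q$, by $$F_{2}(A;B,B';C,C';x,y)=\varepsilon(xy)\,BB'CC'(-1)\sum_{u,v\in\mathbb{F}_q}B(u)B'(v)\,\overline{B}C(1-u)\,\overline{B'}C'(1-v)\,\overline{A}(1-ux-vy).$$ *)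

theory Defs
  imports Complex_Main "HOL-Library.Function_Division" "HOL-Library.FuncSet" "HOL-Library.Cardinality"
begin

text \<open>
  The field with \<open>q\<close> elements is a type of class \<open>{field, finite}\<close>, with \<open>q = CARD('a)\<close>.

  A multiplicative character is a homomorphism from the nonzero elements of the field to the
  nonzero complex numbers, extended to the whole field by the value \<open>0\<close> at \<open>0\<close> (also for the
  trivial character). Products and inverses of characters are the pointwise ones of
  \<^theory>\<open>HOL-Library.Function_Division\<close>; as \<open>inverse 0 = 0\<close>, the inverse again vanishes at \<open>0\<close>.
  The \<open>1\<close> of that theory is the constant function and therefore is not the trivial character.
\<close>

definition mult_chars :: "('a::{field,finite} \<Rightarrow> complex) set" where
  "mult_chars = {\<chi>. \<chi> 0 = 0 \<and> (\<forall>x. x \<noteq> 0 \<longrightarrow> \<chi> x \<noteq> 0) \<and>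
     (\<forall>x y. x \<noteq> 0 \<longrightarrow> y \<noteq> 0 \<longrightarrow> \<chi> (x * y) = \<chi> x * \<chi> y)}"

definition triv_char :: "'a::{field,finite} \<Rightarrow> complex" where
  "triv_char x = (if x = 0 then 0 else 1)"

definition jacobi_sum ::
  "('a::{field,finite} \<Rightarrow> complex) \<Rightarrow> ('a \<Rightarrow> complex) \<Rightarrow> complex" where
  "jacobi_sum \<chi> \<psi> = (\<Sum>u\<in>UNIV. \<chi> u * \<psi> (1 - u))"

definition char_binom ::
  "('a::{field,finite} \<Rightarrow> complex) \<Rightarrow> ('a \<Rightarrow> complex) \<Rightarrow> complex" where
  "char_binom A B = B (-1) * jacobi_sum A (inverse B)"

definition hyp_2F1 ::
  "('a::{field,finite} \<Rightarrow> complex) \<Rightarrow> ('a \<Rightarrow> complex) \<Rightarrow> ('a \<Rightarrow> complex) \<Rightarrow> 'a \<Rightarrow> complex" where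
  "hyp_2F1 A B C x = triv_char x * (B * C) (-1) *
     (\<Sum>u\<in>UNIV. B u * (inverse B * C) (1 - u) * inverse A (1 - x * u))"

definition appell_F2 ::
  "('a::{field,finite} \<Rightarrow> complex) \<Rightarrow> ('a \<Rightarrow> complex) \<Rightarrow> ('a \<Rightarrow> complex) \<Rightarrow>
   ('a \<Rightarrow> complex) \<Rightarrow> ('a \<Rightarrow> complex) \<Rightarrow> 'a \<Rightarrow> 'a \<Rightarrow> complex" where
  "appell_F2 A B B' C C' x y = triv_char (x * y) * (B * B' * C * C') (-1) *
     (\<Sum>u\<in>UNIV. \<Sum>v\<in>UNIV. B u * B' v * (inverse B * C) (1 - u) * (inverse B' * C') (1 - v) *
        inverse A (1 - u * x - v * y))"

lemma triv_char_in_mult_chars: "triv_char \<in> mult_chars"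
  by (simp add: mult_chars_def triv_char_def)

lemma times_in_mult_chars: "\<chi> \<in> mult_chars \<Longrightarrow> \<psi> \<in> mult_chars \<Longrightarrow> \<chi> * \<psi> \<in> mult_chars"
  by (simp add: mult_chars_def)

lemma inverse_in_mult_chars: "\<chi> \<in> mult_chars \<Longrightarrow> inverse \<chi> \<in> mult_chars"
  by (simp add: mult_chars_def)

lemma mult_char_inverse: "\<chi> \<in> mult_chars \<Longrightarrow> inverse \<chi> * \<chi> = triv_char"
  by (auto simp: mult_chars_def triv_char_def fun_eq_iff)

text \<open>Sums over \<^const>\<open>mult_chars\<close> are sums over a finite set, hence not zero by default.\<close>

lemma finite_mult_chars: "finite (mult_chars :: ('a::{field,finite} \<Rightarrow> complex) set)"
proof -
  have root: "\<exists>n\<in>{1..CARD('a)}. \<chi> x ^ n = 1"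
    if \<chi>: "\<chi> \<in> mult_chars" and x: "x \<noteq> 0" for \<chi> :: "'a \<Rightarrow> complex" and x
  proof -
    have "card ((\<lambda>n. x ^ n) ` {..CARD('a)}) \<le> CARD('a)"
      by (intro card_mono) auto
    then have "\<not> inj_on (\<lambda>n. x ^ n) {..CARD('a)}"
      using pigeonhole[of "\<lambda>n. x ^ n" "{..CARD('a)}"] by simp
    then obtain i j where ij: "i < j" "j \<le> CARD('a)" "x ^ i = x ^ j"
      unfolding inj_on_def by (metis atMost_iff linorder_neqE_nat)
    have pow: "\<chi> (x ^ Suc n) = \<chi> x ^ Suc n" for n
      using \<chi> x by (induction n) (auto simp: mult_chars_def)
    have nz: "\<chi> x \<noteq> 0"
      using \<chi> x by (simp add: mult_chars_def)
    have "x ^ Suc i = x ^ Suc j"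
      using ij(3) by simp
    then have "\<chi> x ^ Suc i = \<chi> x ^ Suc j"
      using pow[of i] pow[of j] by metis
    also have "\<dots> = \<chi> x ^ Suc i * \<chi> x ^ (j - i)"
      using ij(1) by (simp flip: power_add)
    finally have "\<chi> x ^ (j - i) = 1"
      using nz by simp
    then show ?thesis
      using ij by (intro bexI[of _ "j - i"]) auto
  qed
  define R where "R = insert 0 (\<Union>n\<in>{1..CARD('a)}. {z::complex. z ^ n = 1})"
  have "finite R"
    unfolding R_def by (auto intro!: finite_roots_unity)
  then have "finite (UNIV \<rightarrow> R :: ('a \<Rightarrow> complex) set)"
    using finite_set_of_finite_funs[of "UNIV :: 'a set" R undefined] by (simp add: Pi_def)
  moreover have "mult_chars \<subseteq> (UNIV \<rightarrow> R :: ('a \<Rightarrow> complex) set)"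
  proof
    fix \<chi> :: "'a \<Rightarrow> complex" assume \<chi>: "\<chi> \<in> mult_chars"
    have "\<chi> x \<in> R" for x
      using root[OF \<chi>, of x] \<chi> by (cases "x = 0") (auto simp: R_def mult_chars_def)
    then show "\<chi> \<in> UNIV \<rightarrow> R" by simp
  qed
  ultimately show ?thesis
    by (rule rev_finite_subset)
qed

end

theory Submission
  imports Defs "HOL-Algebra.Multiplicative_Group"
begin

text \<open>
  By orthogonality of characters, the sum over \<open>\<theta>\<close> inside the double sum of \<open>F\<^sub>2\<close>, with
  \<open>L = 1 - ux - vy\<close>, forces the Jacobi sum variable to be \<open>L / (L - t)\<close> and leaves \<open>A\<close> inverted at
  \<open>L - t\<close>, except that the terms with \<open>L = 0\<close> vanish. The unrestricted sum is the first term on the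
  right; since \<open>F\<^sub>2(\<epsilon>; \<dots>)\<close> is the sum over \<open>L \<noteq> 0\<close> and the product of the two binomials is the full
  sum, the correction for \<open>L = 0\<close> is the third one. The two hypergeometric terms cancel each other
  under \<open>u \<mapsto> 1 / u\<close>.
\<close>

section \<open>Values of characters on products, quotients and powers\<close>

text \<open>The definition asks for multiplicativity at nonzero arguments only. Vanishing at 0
  extends it to all arguments, so the rule rewrites without side conditions.\<close>

lemma mult_charD:
  assumes "\<chi> \<in> mult_chars"
  shows mult_char_0: "\<chi> 0 = 0" and mult_char_eq_0_iff: "\<chi> x = 0 \<longleftrightarrow> x = 0"
    and mult_char_mult: "\<chi> (x * y) = \<chi> x * \<chi> y" and mult_char_1: "\<chi> 1 = 1"
proof -
  show 0: "\<chi> 0 = 0" and "\<chi> x = 0 \<longleftrightarrow> x = 0"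
    using assms by (auto simp: mult_chars_def)
  show "\<chi> (x * y) = \<chi> x * \<chi> y"
    using assms by (cases "x = 0 \<or> y = 0") (auto simp: mult_chars_def)
  have "\<chi> 1 \<noteq> 0"
    using assms by (simp add: mult_chars_def)
  moreover have "\<chi> (1 * 1) = \<chi> 1 * \<chi> 1"
    using assms unfolding mult_chars_def by (simp del: mult_1_left mult_1_right)
  ultimately show "\<chi> 1 = 1" by simp
qed

text \<open>The case \<open>x = 0\<close> is covered by the convention \<open>inverse 0 = 0\<close>
  in both fields. Hence the quotient rule below also holds for a zero denominator.\<close>

lemma mult_char_inverse_arg:
  assumes "\<chi> \<in> mult_chars"
  shows "\<chi> (inverse x) = inverse (\<chi> x)"
proof (cases "x = 0")
  case True
  then show ?thesis using assms by (simp add: mult_char_0)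
next
  case False
  then have "\<chi> x * \<chi> (inverse x) = 1"
    using mult_char_mult[OF assms, of x "inverse x"] mult_char_1[OF assms] by simp
  then show ?thesis by (rule inverse_unique[symmetric])
qed

lemma mult_char_divide: "\<chi> \<in> mult_chars \<Longrightarrow> \<chi> (x / y) = \<chi> x / \<chi> y"
  by (simp add: divide_inverse mult_char_mult mult_char_inverse_arg)

lemma mult_char_power: "\<chi> \<in> mult_chars \<Longrightarrow> \<chi> (x ^ n) = \<chi> x ^ n"
  by (induction n) (simp_all add: mult_char_1 mult_char_mult)

lemma mult_char_uminus: "\<chi> \<in> mult_chars \<Longrightarrow> \<chi> (- x) = \<chi> (- 1) * \<chi> x"
  using mult_char_mult[of \<chi> "- 1" x] by simp

lemma mult_char_neg_one_sq: "\<chi> \<in> mult_chars \<Longrightarrow> \<chi> (- 1) * \<chi> (- 1) = 1"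
  using mult_char_mult[of \<chi> "- 1" "- 1"] by (simp add: mult_char_1)

section \<open>Cyclicity of the multiplicative group and orthogonality of characters\<close>

lemma card_finite_field_gt_1: "CARD('a::{field,finite}) > 1"
  using card_mono[of UNIV "{0, 1 :: 'a}"] by simp

text \<open>The cyclicity theorem of \<open>HOL-Algebra\<close> speaks about ring records, so the
  type is repackaged as the record \<open>R\<close> and the result carried back. Exponents are
  confined to \<open>{..<CARD('a) - 1}\<close> so that each nonzero element has a unique discrete
  logarithm.\<close>

lemma finite_field_primitive_element:
  obtains g :: "'a::{field,finite}"
  where "g ^ (CARD('a) - 1) = 1" "bij_betw (\<lambda>i. g ^ i) {..<CARD('a) - 1} (UNIV - {0})"
proof -
  define R :: "'a ring"
    where "R = \<lparr>carrier = UNIV, mult = (*), one = 1, zero = 0, add = (+)\<rparr>"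
  have "cring R"
  proof (rule cringI)
    show "abelian_group R"
      by (rule abelian_groupI) (auto simp: R_def algebra_simps intro: exI[of _ "- x" for x])
    show "comm_monoid R"
      by (rule comm_monoidI) (simp_all add: R_def mult_ac)
  qed (simp add: R_def algebra_simps)
  then have fR: "field R"
  proof (rule cring.cring_fieldI)
    have "\<exists>y. y * x = 1 \<and> x * y = 1" if "x \<noteq> 0" for x :: 'a
      using that by (intro exI[of _ "inverse x"]) simp
    then show "Units R = carrier R - {\<zero>\<^bsub>R\<^esub>}"
      by (auto simp: R_def Units_def)
  qed
  interpret R: field R by (rule fR)
  have fin: "finite (carrier R)"
    by (simp add: R_def)
  obtain g where g: "g \<in> carrier (mult_of R)"
    and gen: "carrier (mult_of R) = {g [^]\<^bsub>R\<^esub> i | i::nat. i \<in> UNIV}"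
    using R.finite_field_mult_group_has_gen[OF fin] by blast
  have pow: "g [^]\<^bsub>R\<^esub> i = g ^ i" for i :: nat
    by (induction i) (simp_all add: R_def nat_pow_def mult.commute)
  have carr: "carrier (mult_of R) = UNIV - {0}"
    by (simp add: R_def)
  have g0: "g \<noteq> 0"
    using g unfolding carr by simp
  let ?N = "CARD('a) - 1"
  have card: "card (UNIV - {0::'a}) = ?N"
    by (simp add: card_Diff_singleton)
  have "g [^]\<^bsub>mult_of R\<^esub> order (mult_of R) = \<one>\<^bsub>mult_of R\<^esub>"
    using g by (rule group.pow_order_eq_1[OF R.field_mult_group])
  then have gN: "g ^ ?N = 1"
    by (simp add: nat_pow_mult_of pow order_def carr card) (simp add: R_def)
  have N: "?N > 0"
    using card_finite_field_gt_1[where 'a='a] by simp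
  have img: "(\<lambda>i. g ^ i) ` {..<?N} = UNIV - {0}"
  proof (intro equalityI subsetI)
    fix x :: 'a assume "x \<in> UNIV - {0}"
    then obtain i where "x = g ^ i"
      using gen unfolding carr pow by blast
    also have "\<dots> = (g ^ ?N) ^ (i div ?N) * g ^ (i mod ?N)"
      by (simp flip: power_mult power_add)
    also have "\<dots> = g ^ (i mod ?N)"
      unfolding gN by simp
    finally show "x \<in> (\<lambda>i. g ^ i) ` {..<?N}"
      using N by (intro image_eqI[of _ _ "i mod ?N"]) simp_all
  qed (use g0 in auto)
  \<comment> \<open>The image has as many elements as the index set, so surjectivity already gives
    injectivity.\<close>
  have "inj_on (\<lambda>i. g ^ i) {..<?N}"
    by (rule eq_card_imp_inj_on) (simp, simp only: img card card_lessThan)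
  with gN img that show ?thesis
    by (auto simp: bij_betw_def)
qed

text \<open>The character is \<open>z\<close> raised to the discrete logarithm to base
  \<open>g\<close>. Logarithms add only modulo \<open>CARD('a) - 1\<close>, and the condition on
  \<open>z\<close> makes its powers insensitive to that reduction.\<close>

lemma mult_char_with_value_at_primitive_element:
  fixes g :: "'a::{field,finite}"
  assumes "g ^ (CARD('a) - 1) = 1" and "bij_betw (\<lambda>i. g ^ i) {..<CARD('a) - 1} (UNIV - {0})"
    and z: "z ^ (CARD('a) - 1) = 1"
  obtains \<chi> where "\<chi> \<in> mult_chars" "\<chi> g = z"
proof -
  let ?N = "CARD('a) - 1"
  \<comment> \<open>The discrete logarithm to base \<open>g\<close>.\<close>
  let ?l = "the_inv_into {..<?N} (\<lambda>i. g ^ i)"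
  have inj: "inj_on (\<lambda>i. g ^ i) {..<?N}" and img: "(\<lambda>i. g ^ i) ` {..<?N} = UNIV - {0}"
    using assms(2) by (auto simp: bij_betw_def)
  have N: "?N > 0"
    using card_finite_field_gt_1[where 'a='a] by simp
  have powmod: "w ^ (i mod ?N) = w ^ i" if "w ^ ?N = 1" for w :: "'b::monoid_mult" and i
  proof -
    have "w ^ i = (w ^ ?N) ^ (i div ?N) * w ^ (i mod ?N)"
      by (simp flip: power_mult power_add)
    then show ?thesis unfolding that by simp
  qed
  have l: "z ^ ?l (g ^ i) = z ^ i" for i
  proof -
    have "?l (g ^ i) = ?l (g ^ (i mod ?N))"
      unfolding powmod[OF assms(1)] ..
    also have "\<dots> = i mod ?N"
      using N by (intro the_inv_into_f_f[OF inj]) simp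
    finally show ?thesis using powmod[OF z, of i] by simp
  qed
  have z0: "z \<noteq> 0"
    using z N by (metis power_eq_0_iff zero_neq_one zero_power)
  have g0: "g \<noteq> 0"
    using assms(1) N by (metis zero_neq_one zero_power)
  have gl: "\<exists>i. x = g ^ i" if "x \<noteq> 0" for x
    using img that by blast
  define \<chi> where "\<chi> x = (if x = 0 then 0 else z ^ ?l x)" for x
  have "\<chi> (x * y) = \<chi> x * \<chi> y" if "x \<noteq> 0" "y \<noteq> 0" for x y
  proof -
    obtain i j where "x = g ^ i" "y = g ^ j"
      using gl \<open>x \<noteq> 0\<close> \<open>y \<noteq> 0\<close> by blast
    then have "z ^ ?l (x * y) = z ^ ?l x * z ^ ?l y"
      using l[of i] l[of j] l[of "i + j"] by (simp add: power_add)
    then show ?thesis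
      using that by (simp add: \<chi>_def)
  qed
  then have "\<chi> \<in> mult_chars"
    using z0 by (simp add: mult_chars_def) (simp add: \<chi>_def)
  moreover have "\<chi> g = z"
    using l[of 1] g0 by (simp add: \<chi>_def)
  ultimately show ?thesis by (rule that)
qed

text \<open>Sending a generator to a primitive root of unity of order q - 1 gives a character that
  is injective on the nonzero elements, so one construction serves every \<open>a\<close>.\<close>

lemma mult_char_separates_one:
  fixes a :: "'a::{field,finite}"
  assumes "a \<noteq> 0" "a \<noteq> 1"
  obtains \<chi> where "\<chi> \<in> mult_chars" "\<chi> a \<noteq> 1"
proof -
  let ?N = "CARD('a) - 1"
  obtain g :: 'a where g: "g ^ ?N = 1" "bij_betw (\<lambda>i. g ^ i) {..<?N} (UNIV - {0})"
    by (rule finite_field_primitive_element)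
  then obtain i where i: "i < ?N" "a = g ^ i"
    using assms(1) unfolding bij_betw_def by blast
  have "i \<noteq> 0"
    using i assms(2) by (auto intro: ccontr)
  let ?z = "cis (2 * pi / real ?N)"
  have "?z ^ ?N = 1"
    using i(1) by (simp add: Complex.DeMoivre)
  then obtain \<chi> where \<chi>: "\<chi> \<in> mult_chars" "\<chi> g = ?z"
    using mult_char_with_value_at_primitive_element[OF g] by metis
  have "\<chi> a \<noteq> 1"
  proof
    assume "\<chi> a = 1"
    then have "cis (2 * pi * real i / real ?N) = cis (2 * pi * real 0 / real ?N)"
      using \<chi> by (simp add: i(2) mult_char_power Complex.DeMoivre mult_ac)
    moreover have "inj_on (\<lambda>k. cis (2 * pi * real k / real ?N)) {..<?N}"
      using bij_betw_roots_unity[of ?N] i(1) by (auto simp: bij_betw_def)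
    ultimately show False
      using i(1) \<open>i \<noteq> 0\<close> by (auto dest: inj_onD[where x = i and y = 0])
  qed
  with \<chi>(1) show ?thesis by (rule that)
qed

text \<open>A character is determined by its value at a generator, and this value can be any root of
  unity of order dividing q - 1.\<close>

lemma card_mult_chars: "card (mult_chars :: ('a::{field,finite} \<Rightarrow> complex) set) = CARD('a) - 1"
proof -
  let ?N = "CARD('a) - 1"
  obtain g :: 'a where g: "g ^ ?N = 1" "bij_betw (\<lambda>i. g ^ i) {..<?N} (UNIV - {0})"
    by (rule finite_field_primitive_element)
  have gl: "\<exists>i. x = g ^ i" if "x \<noteq> 0" for x
    using g(2) that unfolding bij_betw_def by blast
  have N: "?N > 0"
    using card_finite_field_gt_1[where 'a='a] by simp
  have "bij_betw (\<lambda>\<chi>. \<chi> g) mult_chars {z::complex. z ^ ?N = 1}"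
  proof (rule bij_betwI')
    fix \<chi> \<psi> :: "'a \<Rightarrow> complex" assume \<chi>: "\<chi> \<in> mult_chars" and \<psi>: "\<psi> \<in> mult_chars"
    have "\<chi> = \<psi>" if "\<chi> g = \<psi> g"
    proof
      fix x show "\<chi> x = \<psi> x"
      proof (cases "x = 0")
        case False
        then obtain i where "x = g ^ i" using gl by blast
        then show ?thesis using that \<chi> \<psi> by (simp add: mult_char_power)
      qed (use \<chi> \<psi> in \<open>simp add: mult_char_0\<close>)
    qed
    then show "(\<chi> g = \<psi> g) = (\<chi> = \<psi>)" by blast
  next
    fix \<chi> :: "'a \<Rightarrow> complex" assume \<chi>: "\<chi> \<in> mult_chars"
    show "\<chi> g \<in> {z. z ^ ?N = 1}"
      using mult_char_power[OF \<chi>, of g ?N] g(1) mult_char_1[OF \<chi>] by simp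
  next
    fix z :: complex assume "z \<in> {z. z ^ ?N = 1}"
    then show "\<exists>\<chi>\<in>mult_chars. z = \<chi> g"
      using mult_char_with_value_at_primitive_element[OF g, of z] by blast
  qed
  then show ?thesis
    using N by (simp add: bij_betw_same_card card_roots_unity_eq)
qed

text \<open>Multiplication by a character \<chi> with \<open>\<chi> a \<noteq> 1\<close> permutes
  the characters, so the sum equals \<open>\<chi> a\<close> times itself and vanishes. At
  \<open>a = 1\<close> it counts the characters; at \<open>a = 0\<close> every summand is 0.\<close>

lemma sum_mult_chars:
  fixes a :: "'a::{field,finite}"
  shows "(\<Sum>\<theta>\<in>mult_chars. \<theta> a) = (if a = 1 then of_nat CARD('a) - 1 else 0)"
proof -
  consider "a = 0" | "a = 1" | "a \<noteq> 0" "a \<noteq> 1" by blast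
  then show ?thesis
  proof cases
    case 1
    then show ?thesis by (simp add: mult_char_0)
  next
    case 2
    then show ?thesis by (simp add: mult_char_1 card_mult_chars of_nat_diff Suc_leI)
  next
    case 3
    then obtain \<chi> where \<chi>: "\<chi> \<in> mult_chars" "\<chi> a \<noteq> 1"
      by (rule mult_char_separates_one)
    \<comment> \<open>The unit of the group of characters is \<open>triv_char\<close>, not the
      constant function \<open>1\<close>, so cancellation is checked pointwise; at 0 it holds
      because \<theta> vanishes there.\<close>
    have cancel: "\<psi> * (inverse \<psi> * \<theta>) = \<theta>" if "\<psi> \<in> mult_chars" "\<theta> \<in> mult_chars"
      for \<psi> \<theta> :: "'a \<Rightarrow> complex"
      using that by (auto simp: fun_eq_iff mult_char_0 mult_char_eq_0_iff field_simps)
    have "(\<Sum>\<theta>\<in>mult_chars. \<theta> a) = (\<Sum>\<theta>\<in>mult_chars. (\<chi> * \<theta>) a)"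
    proof (rule sum.reindex_bij_witness[of _ "\<lambda>\<theta>. \<chi> * \<theta>" "\<lambda>\<theta>. inverse \<chi> * \<theta>"])
      fix \<theta> :: "'a \<Rightarrow> complex" assume \<theta>: "\<theta> \<in> mult_chars"
      show "\<chi> * (inverse \<chi> * \<theta>) = \<theta>" by (rule cancel[OF \<chi>(1) \<theta>])
      show "inverse \<chi> * (\<chi> * \<theta>) = \<theta>"
        using cancel[OF \<chi>(1) \<theta>] by (simp add: mult.left_commute)
    qed (use \<chi>(1) cancel in \<open>auto intro!: times_in_mult_chars inverse_in_mult_chars\<close>)
    also have "\<dots> = \<chi> a * (\<Sum>\<theta>\<in>mult_chars. \<theta> a)"
      by (simp add: sum_distrib_left)
    finally have "(1 - \<chi> a) * (\<Sum>\<theta>\<in>mult_chars. \<theta> a) = 0"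
      by (simp add: algebra_simps)
    then show ?thesis using \<chi>(2) 3 by simp
  qed
qed

section \<open>Summation over \<theta> for a fixed argument of the characters\<close>

text \<open>After expanding the Jacobi sum, all factors \<theta> merge into one value
  \<open>\<theta> (- (w * t) / ((1 - w) * s))\<close>. Orthogonality keeps only the \<open>w\<close>
  for which this argument is 1, namely \<open>w = s / (s - t)\<close>, and there
  \<open>A w / A s\<close> is the inverse of \<open>A (s - t)\<close>.\<close>

lemma sum_char_binom:
  fixes A :: "'a::{field,finite} \<Rightarrow> complex" and s t :: 'a
  assumes A: "A \<in> mult_chars" and "t \<noteq> 0"
  shows "(\<Sum>\<theta>\<in>mult_chars. char_binom (A * \<theta>) \<theta> * inverse (A * \<theta>) s * \<theta> t) =
    (of_nat CARD('a) - 1) * (if s = 0 then 0 else inverse A (s - t))"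
proof (cases "s = 0")
  case True
  then show ?thesis
    using A by (auto intro!: sum.neutral simp: mult_char_0)
next
  case False
  \<comment> \<open>At \<open>w = 1\<close> the left quotient is 0 by the convention on division by
    zero, while \<open>s / (s - t) = 1\<close> would force \<open>t = 0\<close>; so both sides are
    false.\<close>
  have sol: "- (w * t) / ((1 - w) * s) = 1 \<longleftrightarrow> s \<noteq> t \<and> w = s / (s - t)" for w
  proof (cases "w = 1")
    case True
    then show ?thesis
      using \<open>t \<noteq> 0\<close> by (simp add: eq_divide_eq)
  next
    case neq: False
    have "- (w * t) / ((1 - w) * s) = 1 \<longleftrightarrow> w * (s - t) = s"
      using neq \<open>s \<noteq> 0\<close> by (subst divide_eq_1_iff) (simp_all, auto simp: algebra_simps)
    also have "\<dots> \<longleftrightarrow> s \<noteq> t \<and> w = s / (s - t)"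
      using \<open>s \<noteq> 0\<close> by (auto simp: eq_divide_eq)
    finally show ?thesis .
  qed
  have "(\<Sum>\<theta>\<in>mult_chars. char_binom (A * \<theta>) \<theta> * inverse (A * \<theta>) s * \<theta> t) =
    (\<Sum>\<theta>\<in>mult_chars. \<Sum>w\<in>UNIV. A w * inverse (A s) * \<theta> (- (w * t) / ((1 - w) * s)))"
  proof (rule sum.cong[OF refl])
    fix \<theta> :: "'a \<Rightarrow> complex" assume \<theta>: "\<theta> \<in> mult_chars"
    have "\<theta> (- 1) * (A w * \<theta> w * inverse (\<theta> (1 - w))) * inverse (A s * \<theta> s) * \<theta> t =
      A w * inverse (A s) * \<theta> (- (w * t) / ((1 - w) * s))" for w
    proof -
      have "\<theta> (- (w * t) / ((1 - w) * s)) = \<theta> (- 1) * (\<theta> w * \<theta> t) / (\<theta> (1 - w) * \<theta> s)"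
        unfolding mult_char_divide[OF \<theta>] mult_char_uminus[OF \<theta>, of "w * t"] mult_char_mult[OF \<theta>] ..
      then show ?thesis
        by (simp only: divide_inverse inverse_mult_distrib mult_ac)
    qed
    then show "char_binom (A * \<theta>) \<theta> * inverse (A * \<theta>) s * \<theta> t =
      (\<Sum>w\<in>UNIV. A w * inverse (A s) * \<theta> (- (w * t) / ((1 - w) * s)))"
      unfolding char_binom_def jacobi_sum_def times_fun_apply inverse_fun_apply sum_distrib_left
        sum_distrib_right by (rule sum.cong[OF refl])
  qed
  also have "\<dots> = (\<Sum>w\<in>UNIV. A w * inverse (A s) * (\<Sum>\<theta>\<in>mult_chars. \<theta> (- (w * t) / ((1 - w) * s))))"
    by (subst sum.swap) (simp add: sum_distrib_left)
  also have "\<dots> = (\<Sum>w\<in>UNIV. if w = s / (s - t) \<and> s \<noteq> t then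
      (of_nat CARD('a) - 1) * (A w * inverse (A s)) else 0)"
    unfolding sum_mult_chars sol by (intro sum.cong) auto
  also have "\<dots> = (of_nat CARD('a) - 1) * inverse A (s - t)"
  \<comment> \<open>For \<open>s = t\<close> no \<open>w\<close> contributes, in agreement with
    \<open>inverse A 0 = 0\<close>.\<close>
  proof (cases "s = t")
    case True
    then show ?thesis using A by (simp add: mult_char_0)
  next
    case neq: False
    have "A (s / (s - t)) * inverse (A s) = inverse A (s - t)"
      unfolding mult_char_divide[OF A] using A False by (simp add: mult_char_eq_0_iff divide_inverse)
    then show ?thesis using neq by simp
  qed
  finally show ?thesis using False by simp
qed

section \<open>Transformations of the binomial coefficient and of the 2F1\<close>

text \<open>The involution \<open>u / (u - 1)\<close> of the field without 1 turns the Jacobi sum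
  into the kernel of the hypergeometric series. In this shape, a product of two binomials is the
  double sum of \<open>appell_F2\<close> without its \<open>A\<close> factor.\<close>

lemma char_binom_eq:
  fixes B C :: "'a::{field,finite} \<Rightarrow> complex"
  assumes B: "B \<in> mult_chars" and C: "C \<in> mult_chars"
  shows "char_binom B C = (B * C) (-1) * (\<Sum>u\<in>UNIV. B u * (inverse B * C) (1 - u))"
proof -
  let ?f = "\<lambda>u. B u * (inverse B * C) (1 - u)" and ?g = "\<lambda>u. B u * inverse C (1 - u)"
  \<comment> \<open>The point 1, where the substitution breaks down, contributes 0 to both
    sums.\<close>
  have "(\<Sum>u\<in>UNIV. ?f u) = (\<Sum>u\<in>UNIV - {1}. ?f u)"
    using B by (simp add: sum.remove[of _ 1] mult_char_0)
  also have "\<dots> = (\<Sum>u\<in>UNIV - {1}. B (-1) * ?g u)"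
  proof (rule sum.reindex_bij_witness[of _ "\<lambda>u. u / (u - 1)" "\<lambda>u. u / (u - 1)"])
    fix u :: 'a assume "u \<in> UNIV - {1}"
    then have u: "u - 1 \<noteq> 0" by simp
    have *: "u / (u - 1) - 1 = 1 / (u - 1)" "1 - u / (u - 1) = inverse (1 - u)"
      using u by (simp_all add: divide_simps)
    show "u / (u - 1) / (u / (u - 1) - 1) = u" and "u / (u - 1) / (u / (u - 1) - 1) = u"
      unfolding * using u by simp_all
    show "u / (u - 1) \<in> UNIV - {1}"
      using u by (simp add: divide_eq_eq)
    have "B (u - 1) = B (-1) * B (1 - u)"
      using mult_char_uminus[OF B, of "1 - u"] by simp
    moreover have "B (-1) * inverse (B (-1)) = 1"
      using B by (simp add: mult_char_eq_0_iff)
    moreover have "(inverse C) (inverse (1 - u)) = C (1 - u)"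
      by (simp add: mult_char_inverse_arg[OF C])
    ultimately show "B (-1) * ?g (u / (u - 1)) = ?f u"
      using mult_char_neg_one_sq[OF B] unfolding * mult_char_divide[OF B]
      by (auto simp: divide_inverse)
  qed auto
  also have "\<dots> = B (-1) * (\<Sum>u\<in>UNIV. ?g u)"
    using C by (simp add: sum.remove[of _ 1] mult_char_0 sum_distrib_left)
  finally have "(\<Sum>u\<in>UNIV. ?f u) = B (-1) * jacobi_sum B (inverse C)"
    by (simp add: jacobi_sum_def)
  then show ?thesis
    using mult_char_neg_one_sq[OF B] by (simp add: char_binom_def mult_ac)
qed

text \<open>The substitution of \<open>inverse u\<close> for \<open>u\<close> is an involution of
  the whole field, because \<open>inverse 0 = 0\<close>, and both summands vanish at 0. Elsewhere
  the powers of \<open>u\<close>, \<open>x\<close> and \<open>t\<close> pulled out of the characters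
  account for the change of parameters and for the prefactors.\<close>

lemma hyp_2F1_reflect:
  fixes A B C :: "'a::{field,finite} \<Rightarrow> complex" and x t :: 'a
  assumes A: "A \<in> mult_chars" and B: "B \<in> mult_chars" and C: "C \<in> mult_chars"
    and x: "x \<noteq> 0" and t: "t \<noteq> 0"
  shows "(B * C) (-1) * inverse A (-x) * hyp_2F1 A (A * inverse C) (A * inverse B) (- (t / x)) =
    inverse A (-t) * hyp_2F1 A B C (- (x / t))"
proof -
  let ?f = "\<lambda>u. B u * (inverse B * C) (1 - u) * inverse A (1 - - (x / t) * u)"
  let ?g = "\<lambda>u. (A * inverse C) u * (inverse (A * inverse C) * (A * inverse B)) (1 - u) *
    inverse A (1 - - (t / x) * u)"
  have "(\<Sum>u\<in>UNIV. ?g u) = (\<Sum>u\<in>UNIV. (B * C) (-1) * (A x * inverse A t) * ?f u)"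
  proof (rule sum.reindex_bij_witness[of _ inverse inverse])
    fix u :: 'a
    show "(B * C) (-1) * (A x * inverse A t) * ?f (inverse u) = ?g u"
    proof (cases "u = 0")
      case True
      then show ?thesis using B A by (simp add: mult_char_0)
    next
      case u: False
      have 1: "1 - inverse u = - ((1 - u) / u)"
        using u by (simp add: field_simps)
      have 2: "1 - - (x / t) * inverse u = x * (1 - - (t / x) * u) / (t * u)"
        using u x t by (simp add: field_simps)
      have nz: "A u \<noteq> 0" "B u \<noteq> 0" "C u \<noteq> 0" "A x \<noteq> 0" "A t \<noteq> 0" "B (-1) \<noteq> 0"
        using u x t A B C by (simp_all add: mult_char_eq_0_iff)
      have f: "B (inverse u) * (inverse (B (1 - inverse u)) * C (1 - inverse u)) *
            inverse (A (1 - - (x / t) * inverse u)) = inverse (B u) * (inverse (B (-1) * (B (1 - u) / B u)) *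
          (C (-1) * (C (1 - u) / C u))) * inverse (A x * A (1 - - (t / x) * u) / (A t * A u))"
        unfolding 1 2 mult_char_uminus[OF B, of "_ / _"]
          mult_char_uminus[OF C, of "_ / _"] mult_char_inverse_arg[OF B] mult_char_divide[OF A]
          mult_char_divide[OF B] mult_char_divide[OF C] mult_char_mult[OF A] ..
      have "(B * C) (-1) * (A x * inverse A t) * ?f (inverse u) =
          (C (-1) * C (-1)) * (A u / C u * (C (1 - u) / B (1 - u)) * inverse (A (1 - - (t / x) * u)))"
      proof -
        \<comment> \<open>The character values become free complex variables. Here \<open>p\<close>
          and \<open>r\<close> stand for \<open>B (1 - u)\<close> and the last value of
          \<open>A\<close>, which may be 0; both sides are then 0.\<close>
        have "b1 * c1 * (ax * inverse a0) * (inverse bu * (inverse (b1 * (p / bu)) * (c1 * (q / cu))) *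
            inverse (ax * r / (a0 * au))) = c1 * c1 * (au / cu * (q / p) * inverse r)"
          if "au \<noteq> 0" "bu \<noteq> 0" "cu \<noteq> 0" "ax \<noteq> 0" "a0 \<noteq> 0" "b1 \<noteq> 0"
          for au bu cu ax a0 b1 c1 p q r :: complex
          using that by (cases "p = 0"; cases "r = 0") (simp_all add: field_simps)
        from this[OF nz] show ?thesis
          unfolding times_fun_apply inverse_fun_apply f .
      qed
      \<comment> \<open>In \<open>?g u\<close> the factor \<open>A (1 - u)\<close> meets its
        inverse. They cancel except at \<open>u = 1\<close>, where both sides are 0.\<close>
      also have "\<dots> = ?g u"
        using mult_char_neg_one_sq[OF C] mult_char_eq_0_iff[OF A, of "1 - u"] mult_char_0[OF C]
        by (cases "u = 1") (simp_all add: divide_inverse)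
      finally show ?thesis .
    qed
  qed auto
  then have g: "(\<Sum>u\<in>UNIV. ?g u) = (B * C) (-1) * (A x * inverse A t) * (\<Sum>u\<in>UNIV. ?f u)"
    by (simp add: sum_distrib_left)
  define F where "F = (\<Sum>u\<in>UNIV. ?f u)"
  have nz: "A x \<noteq> 0" "A t \<noteq> 0" "B (-1) \<noteq> 0" "C (-1) \<noteq> 0" "A (-1) \<noteq> 0"
    using A B C x t by (simp_all add: mult_char_eq_0_iff)
  have "hyp_2F1 A (A * inverse C) (A * inverse B) (- (t / x)) =
      ((A * inverse C) * (A * inverse B)) (-1) * ((B * C) (-1) * (A x * inverse A t) * F)"
    using x t unfolding hyp_2F1_def g F_def[symmetric] by (simp add: triv_char_def)
  also have "\<dots> = (A (-1) * A (-1)) * (A x * inverse A t * F)"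
    using nz by (simp add: field_simps)
  finally have "hyp_2F1 A (A * inverse C) (A * inverse B) (- (t / x)) = A x * inverse A t * F"
    unfolding mult_char_neg_one_sq[OF A] by simp
  moreover have "hyp_2F1 A B C (- (x / t)) = (B * C) (-1) * F"
    using x t unfolding hyp_2F1_def F_def[symmetric] by (simp add: triv_char_def)
  ultimately show ?thesis
    using nz mult_char_uminus[OF A, of x] mult_char_uminus[OF A, of t] by simp
qed

section \<open>Assembly of the identity for the Appell series\<close>

theorem theorem4p1:
  fixes A B B' C C' :: "'a::{field,finite} \<Rightarrow> complex" and x y t :: 'a
  assumes "A \<in> mult_chars" and "B \<in> mult_chars" and "B' \<in> mult_chars"
    and "C \<in> mult_chars" and "C' \<in> mult_chars"
    and "x \<noteq> 0" and "t \<noteq> 0" and "t \<noteq> 1"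
  shows "1 / (of_nat CARD('a) - 1) *
      (\<Sum>\<theta>\<in>mult_chars. char_binom (A * \<theta>) \<theta> * appell_F2 (A * \<theta>) B B' C C' x y * \<theta> t) =
    inverse A (1 - t) * appell_F2 A B B' C C' (x / (1 - t)) (y / (1 - t))
    - inverse A (-t) * inverse C' y * (inverse B' * C') (1 - y) * hyp_2F1 A B C (- (x / t))
    - inverse A (-t) *
        (char_binom B C * char_binom B' C' * triv_char y - appell_F2 triv_char B B' C C' x y)
    + (B * C) (-1) * inverse A (-x) * inverse C' y * (inverse B' * C') (1 - y) *
        hyp_2F1 A (A * inverse C) (A * inverse B) (- (t / x))"
proof (cases "y = 0")
  \<comment> \<open>Each term on either side contains a factor \<open>triv_char\<close> at 0 or
    \<open>inverse C' 0\<close>, so the identity reads 0 = 0.\<close>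
  case True
  then show ?thesis
    using assms by (simp add: appell_F2_def triv_char_def mult_char_0)
next
  case y: False
  let ?q = "of_nat CARD('a) - 1 :: complex"
  \<comment> \<open>\<open>K\<close> is the sign common to all the Appell series and to the product
    of the two binomials; \<open>W\<close> is the part of the summand without \<open>A\<close>. The
    sums \<open>S\<close> and \<open>T\<close> run over all pairs, while \<open>T0\<close> keeps
    only those with \<open>L u v = 0\<close>.\<close>
  define K where "K = (B * B' * C * C') (-1)"
  define W where "W u v = B u * B' v * (inverse B * C) (1 - u) * (inverse B' * C') (1 - v)" for u v
  define L where "L u v = 1 - u * x - v * y" for u v
  define \<delta> where "\<delta> u v = (if L u v = 0 then 1 else 0 :: complex)" for u v
  define S where "S = (\<Sum>u\<in>UNIV. \<Sum>v\<in>UNIV. W u v * inverse A (L u v - t))"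
  define T where "T = (\<Sum>u\<in>UNIV. \<Sum>v\<in>UNIV. W u v)"
  define T0 where "T0 = (\<Sum>u\<in>UNIV. \<Sum>v\<in>UNIV. W u v * \<delta> u v)"
  have q: "?q \<noteq> 0"
    using card_finite_field_gt_1[where 'a='a] by (metis eq_iff_diff_eq_0 less_irrefl of_nat_1 of_nat_eq_iff)
  have F2_gen: "appell_F2 \<chi> B B' C C' x' y' =
      K * (\<Sum>u\<in>UNIV. \<Sum>v\<in>UNIV. W u v * inverse \<chi> (1 - u * x' - v * y'))"
    if "x' \<noteq> 0" "y' \<noteq> 0" for \<chi> x' y'
    using that by (simp add: appell_F2_def triv_char_def K_def W_def)
  have F2: "appell_F2 \<chi> B B' C C' x y = K * (\<Sum>u\<in>UNIV. \<Sum>v\<in>UNIV. W u v * inverse \<chi> (L u v))"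
    for \<chi>
    unfolding L_def by (rule F2_gen[OF \<open>x \<noteq> 0\<close> y])
  have "(\<Sum>\<theta>\<in>mult_chars. char_binom (A * \<theta>) \<theta> * appell_F2 (A * \<theta>) B B' C C' x y * \<theta> t)
    = (\<Sum>\<theta>\<in>mult_chars. \<Sum>u\<in>UNIV. \<Sum>v\<in>UNIV.
        K * W u v * (char_binom (A * \<theta>) \<theta> * inverse (A * \<theta>) (L u v) * \<theta> t))"
    unfolding F2 by (simp add: sum_distrib_left sum_distrib_right mult_ac)
  also have "\<dots> = (\<Sum>u\<in>UNIV. \<Sum>v\<in>UNIV. \<Sum>\<theta>\<in>mult_chars.
        K * W u v * (char_binom (A * \<theta>) \<theta> * inverse (A * \<theta>) (L u v) * \<theta> t))"
    by (subst sum.swap, rule sum.cong[OF refl], rule sum.swap)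
  also have "\<dots> = (\<Sum>u\<in>UNIV. \<Sum>v\<in>UNIV.
        K * W u v * (?q * (if L u v = 0 then 0 else inverse A (L u v - t))))"
    unfolding sum_distrib_left[symmetric] sum_char_binom[OF \<open>A \<in> mult_chars\<close> \<open>t \<noteq> 0\<close>] ..
  \<comment> \<open>Where \<open>L u v = 0\<close>, the argument \<open>L u v - t\<close> is
    \<open>-t\<close>, so the subtracted term removes exactly the excluded summands.\<close>
  also have "\<dots> = (\<Sum>u\<in>UNIV. \<Sum>v\<in>UNIV.
        ?q * K * (W u v * inverse A (L u v - t) - inverse A (-t) * (W u v * \<delta> u v)))"
    by (intro sum.cong) (simp_all add: \<delta>_def)
  also have "\<dots> = ?q * K * (S - inverse A (-t) * T0)"
    by (simp add: S_def T0_def sum_subtractf flip: sum_distrib_left)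
  finally have lhs: "1 / ?q * (\<Sum>\<theta>\<in>mult_chars. char_binom (A * \<theta>) \<theta> * appell_F2 (A * \<theta>) B B' C C' x y * \<theta> t)
    = K * (S - inverse A (-t) * T0)"
    using q by simp
  \<comment> \<open>Pulling \<open>1 - t\<close> out of the argument turns the rescaled series into
    the unrestricted sum \<open>S\<close>.\<close>
  have shift: "inverse A (1 - t) * inverse A (1 - u * (x / (1 - t)) - v * (y / (1 - t))) =
      inverse A (L u v - t)" for u v
  proof -
    have "L u v - t = (1 - t) * (1 - u * (x / (1 - t)) - v * (y / (1 - t)))"
      using \<open>t \<noteq> 1\<close> by (simp add: L_def right_diff_distrib)
    then show ?thesis
      using \<open>A \<in> mult_chars\<close> by (simp add: mult_char_mult)
  qed
  have "x / (1 - t) \<noteq> 0" "y / (1 - t) \<noteq> 0"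
    using y \<open>x \<noteq> 0\<close> \<open>t \<noteq> 1\<close> by simp_all
  then have S: "inverse A (1 - t) * appell_F2 A B B' C C' (x / (1 - t)) (y / (1 - t)) = K * S"
    unfolding S_def shift[symmetric] by (subst F2_gen) (simp_all add: sum_distrib_left mult_ac)
  have binom: "char_binom B C * char_binom B' C' = K * T"
    using assms by (simp add: char_binom_eq K_def T_def W_def sum_product mult_ac)
  \<comment> \<open>Since \<open>inverse 0 = 0\<close>, the trivial character is its own inverse and
    acts as the indicator of \<open>L u v \<noteq> 0\<close>.\<close>
  have "W u v * inverse triv_char (L u v) = W u v - W u v * \<delta> u v" for u v
    by (simp add: triv_char_def \<delta>_def)
  then have triv: "appell_F2 triv_char B B' C C' x y = K * (T - T0)"
    by (simp add: F2 T_def T0_def sum_subtractf)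
  have refl: "(B * C) (-1) * inverse A (-x) * inverse C' y * (inverse B' * C') (1 - y) *
        hyp_2F1 A (A * inverse C) (A * inverse B) (- (t / x)) =
      inverse A (-t) * inverse C' y * (inverse B' * C') (1 - y) * hyp_2F1 A B C (- (x / t))"
    using hyp_2F1_reflect[of A B C x t] assms by (simp add: mult_ac)
  have y1: "triv_char y = 1"
    using y by (simp add: triv_char_def)
  \<comment> \<open>Here \<open>a\<close> is \<open>inverse A (-t)\<close> and \<open>b\<close> is
    the common value of the two hypergeometric terms.\<close>
  have "K * (S - a * T0) = K * S - b - a * (K * T * 1 - K * (T - T0)) + b" for a b
    by (simp add: algebra_simps)
  then show ?thesis
    unfolding lhs S binom triv refl y1 .
qed

end
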